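(* Let $L$ be the group of quadruples $(a,b,c,d)\in\mathbb{C}^4$ with $ad-bc\neq 0$ under the composition $(a,b,c,d)\circ(a',b',c',d')=(aa'+bc',ab'+bd',ca'+dc',cb'+dd')$, and let $\sim$ be the proportionality relation on $L$. Then $\sim$ is an equivalence relation, the composition, inversion and identity of $L$ induce well-defined operations on the quotient set $L/{\sim}$ making it a group, and this group is isomorphic to $\operatorname{PGL}(2,\mathbb{C})=\operatorname{GL}(2,\mathbb{C})/\mathbb{C}^{\times}$ via the map sending the class of $(a,b,c,d)$ to the class of the matrix $\begin{pmatrix} a & b\\ c& d\end{pmatrix}$.
   Context: Proportionality: $(a_1,b_1,c_1,d_1)\sim(a_2,b_2,c_2,d_2)$ if and only if there is $k\in\mathbb{C}$, $k\neq 0$, with $a_2=ka_1$, $b_2=kb_1$, $c_2=kc_1$, $d_2=kd_1$. Here $\mathbb{C}^{\times}$ is identified with the subgroup of nonzero scalar matrices in $\operatorname{GL}(2,\mathbb{C})$. *)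

theory Defs
  imports "HOL-Analysis.Analysis" "HOL-Algebra.Coset"
begin

type_synonym quadruple = "complex \<times> complex \<times> complex \<times> complex"

definition quad_group :: "quadruple monoid" where
  "quad_group =
    \<lparr> carrier = {(a, b, c, d). a * d - b * c \<noteq> 0},
      mult = (\<lambda>(a, b, c, d) (a', b', c', d').
        (a * a' + b * c', a * b' + b * d', c * a' + d * c', c * b' + d * d')),
      one = (1, 0, 0, 1) \<rparr>"

definition proportional :: "(quadruple \<times> quadruple) set" where
  "proportional =
    {((a\<^sub>1, b\<^sub>1, c\<^sub>1, d\<^sub>1), (a\<^sub>2, b\<^sub>2, c\<^sub>2, d\<^sub>2)) | a\<^sub>1 b\<^sub>1 c\<^sub>1 d\<^sub>1 a\<^sub>2 b\<^sub>2 c\<^sub>2 d\<^sub>2.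
      (a\<^sub>1, b\<^sub>1, c\<^sub>1, d\<^sub>1) \<in> carrier quad_group \<and> (a\<^sub>2, b\<^sub>2, c\<^sub>2, d\<^sub>2) \<in> carrier quad_group \<and>
      (\<exists>k. k \<noteq> 0 \<and> a\<^sub>2 = k * a\<^sub>1 \<and> b\<^sub>2 = k * b\<^sub>1 \<and> c\<^sub>2 = k * c\<^sub>1 \<and> d\<^sub>2 = k * d\<^sub>1)}"

abbreviation quad_class :: "quadruple \<Rightarrow> quadruple set" where
  "quad_class p \<equiv> proportional `` {p}"

text \<open>Operations on classes are unions over all choices of representatives, as in
  \<^theory>\<open>HOL.Equiv_Relations\<close>; such a union is a single class exactly when the underlying
  operation respects the relation.\<close>

definition quad_quotient :: "quadruple set monoid" where
  "quad_quotient =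
    \<lparr> carrier = carrier quad_group // proportional,
      mult = (\<lambda>X Y. \<Union>p\<in>X. \<Union>q\<in>Y. quad_class (p \<otimes>\<^bsub>quad_group\<^esub> q)),
      one = quad_class \<one>\<^bsub>quad_group\<^esub> \<rparr>"

definition quotient_inv :: "quadruple set \<Rightarrow> quadruple set" where
  "quotient_inv X = (\<Union>p\<in>X. quad_class (inv\<^bsub>quad_group\<^esub> p))"

definition GL2 :: "(complex^2^2) monoid" where
  "GL2 = \<lparr> carrier = {A. invertible A}, mult = (**), one = mat 1 \<rparr>"

definition scalars :: "(complex^2^2) set" where
  "scalars = {mat k | k. k \<noteq> 0}"

definition PGL2 :: "(complex^2^2) set monoid" where
  "PGL2 = GL2 Mod scalars"

definition quad_matrix :: "quadruple \<Rightarrow> complex^2^2" where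
  "quad_matrix = (\<lambda>(a, b, c, d). vector [vector [a, b], vector [c, d]])"

abbreviation PGL_class :: "complex^2^2 \<Rightarrow> (complex^2^2) set" where
  "PGL_class A \<equiv> scalars #>\<^bsub>GL2\<^esub> A"

definition PGL_map :: "quadruple set \<Rightarrow> (complex^2^2) set" where
  "PGL_map X = (\<Union>p\<in>X. PGL_class (quad_matrix p))"

lemma group_quad_group: "group quad_group"
proof (rule groupI)
  fix x y assume "x \<in> carrier quad_group" "y \<in> carrier quad_group"
  moreover obtain a b c d where x: "x = (a, b, c, d)" by (cases x)
  moreover obtain a' b' c' d' where y: "y = (a', b', c', d')" by (cases y)
  moreover have "(a * a' + b * c') * (c * b' + d * d') - (a * b' + b * d') * (c * a' + d * c')
    = (a * d - b * c) * (a' * d' - b' * c')" by algebra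
  ultimately show "x \<otimes>\<^bsub>quad_group\<^esub> y \<in> carrier quad_group"
    unfolding quad_group_def by (simp del: right_minus_eq)
next
  fix x assume "x \<in> carrier quad_group"
  moreover obtain a b c d where x: "x = (a, b, c, d)" by (cases x)
  ultimately have D: "a * d - b * c \<noteq> 0" by (simp add: quad_group_def)
  define D where "D = a * d - b * c"
  have nz: "D \<noteq> 0" using D by (simp add: D_def)
  have "(d / D) * (a / D) - (- b / D) * (- c / D) = 1 / D"
    using nz by (simp add: divide_simps) (simp add: D_def algebra_simps)
  then have "(d / D, - b / D, - c / D, a / D) \<in> carrier quad_group"
    using nz by (simp add: quad_group_def del: right_minus_eq)
  moreover have "(d / D, - b / D, - c / D, a / D) \<otimes>\<^bsub>quad_group\<^esub> x = \<one>\<^bsub>quad_group\<^esub>"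
    using nz by (simp add: quad_group_def x divide_simps) (simp add: D_def algebra_simps)
  ultimately show "\<exists>y\<in>carrier quad_group. y \<otimes>\<^bsub>quad_group\<^esub> x = \<one>\<^bsub>quad_group\<^esub>" by blast
qed (auto simp: quad_group_def algebra_simps)

lemma group_GL2: "group GL2"
proof (rule groupI)
  fix A assume "A \<in> carrier GL2"
  then obtain B where "A ** B = mat 1" "B ** A = mat 1"
    by (auto simp: GL2_def invertible_def)
  then show "\<exists>B\<in>carrier GL2. B \<otimes>\<^bsub>GL2\<^esub> A = \<one>\<^bsub>GL2\<^esub>"
    by (auto simp: GL2_def invertible_def intro!: bexI[of _ B])
qed (auto simp: GL2_def invertible_mult matrix_mul_assoc,
     auto simp: invertible_def intro!: exI[of _ "mat 1"])

lemma scalar_mult_comm: "mat k ** A = A ** mat k" for A :: "complex^2^2"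
  by (simp add: matrix_matrix_mult_def mat_def vec_eq_iff sum_2 forall_2 mult.commute)

lemma mat_mult_mat: "mat k ** mat l = (mat (k * l) :: complex^2^2)"
  by (simp add: matrix_matrix_mult_def mat_def vec_eq_iff sum_2 forall_2)

lemma scalars_normal: "scalars \<lhd> GL2"
proof -
  interpret group GL2 by (rule group_GL2)
  have inverse: "mat k ** mat (1 / k) = (mat 1 :: complex^2^2)"
      "mat (1 / k) ** mat k = (mat 1 :: complex^2^2)" if "k \<noteq> 0" for k
    using that by (simp_all add: mat_mult_mat)
  have sub: "scalars \<subseteq> carrier GL2"
    using inverse by (fastforce simp: scalars_def GL2_def invertible_def)
  have "subgroup scalars GL2"
  proof (rule subgroupI[OF sub])
    show "scalars \<noteq> {}" by (auto simp: scalars_def intro: exI[of _ 1])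
  next
    fix A assume A: "A \<in> scalars"
    then obtain k where k: "A = mat k" "k \<noteq> 0" by (auto simp: scalars_def)
    have m: "mat (1 / k) \<in> scalars"
      unfolding scalars_def using k by (intro CollectI exI[of _ "1 / k"]) simp
    have "mat (1 / k) \<otimes>\<^bsub>GL2\<^esub> A = \<one>\<^bsub>GL2\<^esub>"
      using inverse(2)[OF k(2)] by (simp add: GL2_def k(1))
    then have "inv\<^bsub>GL2\<^esub> A = mat (1 / k)"
      using m A sub by (intro inv_equality) auto
    then show "inv\<^bsub>GL2\<^esub> A \<in> scalars" using m by simp
  next
    fix A B assume "A \<in> scalars" "B \<in> scalars"
    then show "A \<otimes>\<^bsub>GL2\<^esub> B \<in> scalars"
      by (fastforce simp: scalars_def GL2_def mat_mult_mat)
  qed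
  moreover have "scalars #>\<^bsub>GL2\<^esub> A = A <#\<^bsub>GL2\<^esub> scalars" for A
    by (auto simp: r_coset_def l_coset_def scalars_def GL2_def scalar_mult_comm)
  ultimately show ?thesis by (simp add: normalI)
qed

end

theory Submission
  imports Defs
begin

text \<open>Proportionality is the kernel relation of the surjective homomorphism
  \<open>p \<mapsto> PGL_class (quad_matrix p)\<close> from \<open>quad_group\<close> onto \<open>PGL2\<close>. Hence it is a congruence,
  and the claim is the first isomorphism theorem for this homomorphism.\<close>

lemma matrix_inj_2: "vector [vector [a, b], vector [c, d]] =
    (vector [vector [a', b'], vector [c', d']] :: 'a::zero^2^2) \<longleftrightarrow> a = a' \<and> b = b' \<and> c = c' \<and> d = d'"
  by (auto simp: vec_eq_iff forall_2)

lemma scalar_mult_matrix_2: "mat k ** vector [vector [a, b], vector [c, d]] =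
    (vector [vector [k * a, k * b], vector [k * c, k * d]] :: 'a::semiring_1^2^2)"
  by (simp add: matrix_matrix_mult_def mat_def vec_eq_iff sum_2 forall_2)

lemma det_quad_matrix: "det (quad_matrix (a, b, c, d)) = a * d - b * c"
  by (simp add: quad_matrix_def det_2)

text \<open>A matrix over a field is invertible exactly when its determinant is nonzero, and the
  condition defining the carrier of \<open>quad_group\<close> is the nonvanishing of that
  determinant.\<close>

lemma quad_matrix_carrier_iff: "quad_matrix p \<in> carrier GL2 \<longleftrightarrow> p \<in> carrier quad_group"
  by (cases p) (simp add: GL2_def quad_group_def invertible_det_nz det_quad_matrix)

lemma quad_matrix_mult:
  "quad_matrix (p \<otimes>\<^bsub>quad_group\<^esub> q) = quad_matrix p \<otimes>\<^bsub>GL2\<^esub> quad_matrix q"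
  by (cases p; cases q)
    (simp add: quad_matrix_def quad_group_def GL2_def matrix_matrix_mult_def vec_eq_iff sum_2 forall_2)

lemma quad_matrix_surj: "\<exists>p. quad_matrix p = A"
  by (rule exI[of _ "(A $ 1 $ 1, A $ 1 $ 2, A $ 2 $ 1, A $ 2 $ 2)"])
    (simp add: quad_matrix_def vec_eq_iff forall_2)

lemma quad_matrix_hom: "quad_matrix \<in> hom quad_group GL2"
  by (simp add: hom_def quad_matrix_carrier_iff quad_matrix_mult)

text \<open>The map is the composite of \<open>quad_matrix\<close> with the canonical projection of
  \<open>GL2\<close> onto its quotient by the normal subgroup \<open>scalars\<close>.\<close>

lemma group_hom_quad_PGL: "group_hom quad_group PGL2 (\<lambda>p. PGL_class (quad_matrix p))"
proof -
  interpret normal scalars GL2 by (rule scalars_normal)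
  have "PGL_class \<circ> quad_matrix \<in> hom quad_group PGL2"
    unfolding PGL2_def
    by (rule Group.hom_compose[OF quad_matrix_hom r_coset_hom_Mod])
  then show ?thesis
    using group_quad_group factorgroup_is_group
    by (simp add: group_hom_def group_hom_axioms_def PGL2_def comp_def)
qed

lemma quad_PGL_surj: "(\<lambda>p. PGL_class (quad_matrix p)) ` carrier quad_group = carrier PGL2"
proof -
  have "quad_matrix ` carrier quad_group = carrier GL2"
  proof (intro equalityI subsetI)
    fix A assume "A \<in> carrier GL2"
    moreover obtain p where "quad_matrix p = A" using quad_matrix_surj by blast
    ultimately show "A \<in> quad_matrix ` carrier quad_group"
      using quad_matrix_carrier_iff by blast
  qed (auto simp: quad_matrix_carrier_iff)
  then have "PGL_class ` quad_matrix ` carrier quad_group = carrier PGL2"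
    by (auto simp: PGL2_def FactGroup_def RCOSETS_def)
  then show ?thesis by (simp add: image_image)
qed

text \<open>Cosets of a subgroup are equal or disjoint, so equality of the two classes amounts to
  \<open>B\<close> lying in the coset of \<open>A\<close>, whose elements are the nonzero scalar
  multiples of \<open>A\<close>.\<close>

lemma PGL_class_eq_iff:
  assumes "A \<in> carrier GL2" "B \<in> carrier GL2"
  shows "PGL_class A = PGL_class B \<longleftrightarrow> (\<exists>k. k \<noteq> 0 \<and> B = mat k ** A)"
proof -
  interpret normal scalars GL2 by (rule scalars_normal)
  have "PGL_class A = PGL_class B \<longleftrightarrow> B \<in> PGL_class A"
    using assms repr_independence[OF _ _ subgroup_axioms] rcos_self[OF _ subgroup_axioms] by metis
  also have "\<dots> \<longleftrightarrow> (\<exists>k. k \<noteq> 0 \<and> B = mat k ** A)"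
    by (auto simp: r_coset_def scalars_def GL2_def)
  finally show ?thesis .
qed

text \<open>This identifies the concrete relation with a kernel relation: a scalar matrix acts by
  multiplying all four entries by \<open>k\<close>. Equivalence, congruence and injectivity below
  all rest on it.\<close>

lemma proportional_iff:
  "(p, q) \<in> proportional \<longleftrightarrow> p \<in> carrier quad_group \<and> q \<in> carrier quad_group \<and>
    PGL_class (quad_matrix p) = PGL_class (quad_matrix q)"
\<comment> \<open>Outside the carrier both sides are false, since \<open>proportional\<close> only
  relates elements of \<open>quad_group\<close>.\<close>
proof (cases "p \<in> carrier quad_group \<and> q \<in> carrier quad_group")
  case True
  then have "PGL_class (quad_matrix p) = PGL_class (quad_matrix q) \<longleftrightarrow>
      (\<exists>k. k \<noteq> 0 \<and> quad_matrix q = mat k ** quad_matrix p)"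
    by (intro PGL_class_eq_iff) (simp_all add: quad_matrix_carrier_iff)
  then show ?thesis using True
    by (cases p; cases q) (simp add: proportional_def quad_matrix_def scalar_mult_matrix_2 matrix_inj_2)
qed (auto simp: proportional_def)

theorem mainTheorem6:
  shows "equiv (carrier quad_group) proportional
    \<and> (\<lambda>p q. quad_class (p \<otimes>\<^bsub>quad_group\<^esub> q)) respects2 proportional
    \<and> (\<lambda>p. quad_class (inv\<^bsub>quad_group\<^esub> p)) respects proportional
    \<and> (\<forall>p\<in>carrier quad_group. \<forall>q\<in>carrier quad_group.
         quad_class p \<otimes>\<^bsub>quad_quotient\<^esub> quad_class q = quad_class (p \<otimes>\<^bsub>quad_group\<^esub> q))
    \<and> (\<forall>p\<in>carrier quad_group. quotient_inv (quad_class p) = quad_class (inv\<^bsub>quad_group\<^esub> p))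
    \<and> group quad_quotient
    \<and> (\<forall>X\<in>carrier quad_quotient. inv\<^bsub>quad_quotient\<^esub> X = quotient_inv X)
    \<and> (\<lambda>p. PGL_class (quad_matrix p)) respects proportional
    \<and> (\<forall>p\<in>carrier quad_group. PGL_map (quad_class p) = PGL_class (quad_matrix p))
    \<and> PGL_map \<in> iso quad_quotient PGL2"
proof -
  let ?f = "\<lambda>p. PGL_class (quad_matrix p)"
  let ?G = "carrier quad_group"
  interpret group_hom quad_group PGL2 ?f by (rule group_hom_quad_PGL)
  have eqv: "equiv ?G proportional"
    by (auto intro!: equivI refl_onI symI transI simp: proportional_iff)
  note class_eq = equiv_class_eq[OF eqv]
  \<comment> \<open>The homomorphism law makes the image of a product depend only on the images of
    its factors; the same argument serves for inverses.\<close>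
  have mult_resp: "(\<lambda>p q. quad_class (p \<otimes>\<^bsub>quad_group\<^esub> q)) respects2 proportional"
    by (rule congruent2I') (auto intro!: class_eq simp: proportional_iff)
  have inv_resp: "(\<lambda>p. quad_class (inv\<^bsub>quad_group\<^esub> p)) respects proportional"
    by (rule congruentI) (auto intro!: class_eq simp: proportional_iff)
  have f_resp: "?f respects proportional"
    by (rule congruentI) (simp add: proportional_iff)
  \<comment> \<open>Since the operation respects the relation, all choices of representatives
    contribute the same class and the union collapses to it.\<close>
  have mult: "quad_class p \<otimes>\<^bsub>quad_quotient\<^esub> quad_class q = quad_class (p \<otimes>\<^bsub>quad_group\<^esub> q)"
    if "p \<in> ?G" "q \<in> ?G" for p q
    using UN_equiv_class2[OF eqv eqv mult_resp that] by (simp add: quad_quotient_def)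
  have q_inv: "quotient_inv (quad_class p) = quad_class (inv\<^bsub>quad_group\<^esub> p)" if "p \<in> ?G" for p
    using UN_equiv_class[OF eqv inv_resp that] by (simp add: quotient_inv_def)
  have map_class: "PGL_map (quad_class p) = ?f p" if "p \<in> ?G" for p
    using UN_equiv_class[OF eqv f_resp that] by (simp add: PGL_map_def)
  have carrier: "carrier quad_quotient = quad_class ` ?G"
    by (auto simp: quad_quotient_def quotient_def)
  have one: "\<one>\<^bsub>quad_quotient\<^esub> = quad_class \<one>\<^bsub>quad_group\<^esub>"
    by (simp add: quad_quotient_def)
  have l_inv: "quad_class (inv\<^bsub>quad_group\<^esub> p) \<otimes>\<^bsub>quad_quotient\<^esub> quad_class p = \<one>\<^bsub>quad_quotient\<^esub>"
    if "p \<in> ?G" for p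
    using that by (simp add: mult one)
  \<comment> \<open>Every element is a class, so \<open>mult\<close> and \<open>one\<close> transfer
    each group law from representatives.\<close>
  have grp: "group quad_quotient"
  proof (rule groupI)
    fix X assume "X \<in> carrier quad_quotient"
    then obtain p where p: "p \<in> ?G" "X = quad_class p" unfolding carrier by blast
    then have "quad_class (inv\<^bsub>quad_group\<^esub> p) \<in> carrier quad_quotient"
      unfolding carrier by blast
    then show "\<exists>Y\<in>carrier quad_quotient. Y \<otimes>\<^bsub>quad_quotient\<^esub> X = \<one>\<^bsub>quad_quotient\<^esub>"
      using l_inv p by blast
  qed (auto simp: carrier one mult G.m_assoc)
  have quotient_inv_eq: "inv\<^bsub>quad_quotient\<^esub> X = quotient_inv X" if X: "X \<in> carrier quad_quotient" for X
  proof -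
    obtain p where p: "p \<in> ?G" "X = quad_class p" using X unfolding carrier by blast
    then have "quad_class (inv\<^bsub>quad_group\<^esub> p) \<in> carrier quad_quotient"
      unfolding carrier by blast
    \<comment> \<open>In a group a left inverse is the inverse, so \<open>l_inv\<close> identifies
      it with the class of \<open>inv p\<close>.\<close>
    then show ?thesis
      using group.inv_equality[OF grp _ X] l_inv p by (simp add: q_inv)
  qed
  have "PGL_map \<in> hom quad_quotient PGL2"
    by (auto simp: hom_def carrier mult map_class)
  \<comment> \<open>Representatives with equal images are proportional by
    \<open>proportional_iff\<close>, hence their classes coincide.\<close>
  moreover have "inj_on PGL_map (carrier quad_quotient)"
    by (auto simp: inj_on_def carrier map_class proportional_iff intro!: class_eq)
  moreover have "PGL_map ` carrier quad_quotient = carrier PGL2"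
    using quad_PGL_surj by (simp add: carrier image_image map_class)
  ultimately have "PGL_map \<in> iso quad_quotient PGL2"
    by (simp add: iso_def bij_betw_def)
  then show ?thesis
    by (intro conjI ballI eqv mult_resp inv_resp mult q_inv grp quotient_inv_eq f_resp map_class)
qed

end
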